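(* Let $f(x,y)=-\beta x-\alpha y+g(x,y)$ be an entire function on $\mathbb{C}^2$, where $\alpha,\beta\in\mathbb{C}$, $\beta\neq 0$, and $g(x,y)=\sum_{i,j\geq 0,\ i+j\geq 2} b_{i,j}x^iy^j\not\equiv 0$. Let $\lambda_1,\lambda_2$ be the roots of $D(\lambda)=\lambda^2+\alpha\lambda+\beta=0$, with $|\lambda_1|\leq|\lambda_2|$. Suppose $|\lambda_1|<1$ or $|\lambda_2|>1$. Put $\lambda=\lambda_1$ in the former case and $\lambda=\lambda_2$ in the latter case (if both hold, either choice may be made). Assume that $\lambda_1^k\neq\lambda_2$ and $\lambda_2^k\neq\lambda_1$ for every $k\in\mathbb{N}$. Let $a_1\neq 0$ be an arbitrary complex number and let $\sum_{n=1}^\infty a_n\lambda^{nt}$ be the formal solution with leading coefficient $a_1$ described in the context. Then there is an $\eta>0$ such that $$u(t)=\sum_{n=1}^{\infty}a_n\lambda^{nt}$$ is a holomorphic solution of the difference equation $u(t+2)=f(u(t),u(t+1))$ in $S(\eta)=\{t\in\mathbb{C}: |\lambda^t|<\eta\}$.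
   Context: Here $t$ is a complex variable and $\mathbb{N}=\{1,2,3,\dots\}$. A branch of $\log\lambda$ is fixed ($\lambda\neq0$ because $\beta\neq 0$) and $\lambda^{nt}=\exp(nt\log\lambda)$. Formal solution: substituting $u(t)=\sum_{n\ge1}a_n\lambda^{nt}$ into $u(t+2)=f(u(t),u(t+1))$ and comparing coefficients of $\lambda^{kt}$ gives $a_1D(\lambda)=0$ and, for $k\geq 2$, $a_kD(\lambda^k)=C_k(a_1,\dots,a_{k-1})$, where $C_k(a_1,\dots,a_{k-1})$ is the coefficient of $\tau^k$ in the formal power series $g(U(\tau),U(\lambda\tau))$, $U(\tau)=\sum_{n\ge1}a_n\tau^n$ (this coefficient depends only on $a_1,\dots,a_{k-1}$). Since $D(\lambda)=0$ and $D(\lambda^k)\neq0$ for $k\geq2$, $a_1$ is arbitrary and $a_k$ ($k\ge 2$) is determined by $a_1$. A function $u$ holomorphic in $S(\eta)$ is a solution in $S(\eta)$ if $u(t+2)=f(u(t),u(t+1))$ whenever $t,t+1,t+2\in S(\eta)$. *)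

theory Defs
  imports "HOL-Complex_Analysis.Complex_Analysis"
begin

text \<open>Entire functions of two complex variables: Frechet differentiability at every point, with
  a complex-linear derivative.\<close>

definition entire2 :: "(complex \<Rightarrow> complex \<Rightarrow> complex) \<Rightarrow> bool" where
  "entire2 f \<longleftrightarrow>
     (\<forall>p. \<exists>A B. ((\<lambda>(x, y). f x y) has_derivative (\<lambda>(h, k). A * h + B * k)) (at p))"

definition char_fun :: "complex \<Rightarrow> complex \<Rightarrow> complex \<Rightarrow> complex" where
  "char_fun \<alpha> \<beta> z = z ^ 2 + \<alpha> * z + \<beta>"

text \<open>The formal power series \<open>\<Sum>\<^bsub>i+j\<ge>2\<^esub> b\<^sub>i\<^sub>j U\<^sup>i V\<^sup>j\<close>, for \<open>U\<close> and \<open>V\<close> without constant term.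
  As in the library's \<^const>\<open>fps_compose\<close>, the terms with \<open>i + j > k\<close> are left out of
  the \<open>k\<close>-th coefficient: they are divisible by \<open>\<tau>\<^bsup>k+1\<^esup>\<close>.\<close>

definition fps_subst2 ::
    "(nat \<Rightarrow> nat \<Rightarrow> complex) \<Rightarrow> complex fps \<Rightarrow> complex fps \<Rightarrow> complex fps" where
  "fps_subst2 b U V =
     Abs_fps (\<lambda>k. \<Sum>(i, j) | 2 \<le> i + j \<and> i + j \<le> k. b i j * fps_nth (U ^ i * V ^ j) k)"

text \<open>\<open>U(\<tau>) = \<Sum>\<^bsub>n\<ge>1\<^esub> a\<^sub>n \<tau>\<^sup>n\<close>; the value \<open>a 0\<close> plays no role.\<close>

definition fps_of_coeffs :: "(nat \<Rightarrow> complex) \<Rightarrow> complex fps" where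
  "fps_of_coeffs a = Abs_fps (\<lambda>n. if n = 0 then 0 else a n)"

definition fps_scale :: "complex \<Rightarrow> complex fps \<Rightarrow> complex fps" where
  "fps_scale c U = fps_compose U (fps_const c * fps_X)"

text \<open>With \<open>\<tau> = \<lambda>\<^sup>t\<close>, the formal series of \<open>u(t)\<close>, \<open>u(t+1)\<close>, \<open>u(t+2)\<close> are \<open>U(\<tau>)\<close>, \<open>U(\<lambda>\<tau>)\<close>,
  \<open>U(\<lambda>\<^sup>2\<tau>)\<close>; the definition is \<open>u(t+2) = -\<beta> u(t) - \<alpha> u(t+1) + g(u(t), u(t+1))\<close> for these.\<close>

definition formal_solution ::
    "complex \<Rightarrow> complex \<Rightarrow> (nat \<Rightarrow> nat \<Rightarrow> complex) \<Rightarrow> complex \<Rightarrow> (nat \<Rightarrow> complex) \<Rightarrow> bool" where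
  "formal_solution \<alpha> \<beta> b lam a \<longleftrightarrow>
     (let U = fps_of_coeffs a in
        fps_scale (lam ^ 2) U =
          - fps_const \<beta> * U - fps_const \<alpha> * fps_scale lam U + fps_subst2 b U (fps_scale lam U))"

lemma formal_solution_iff_recurrence:
  "formal_solution \<alpha> \<beta> b lam a \<longleftrightarrow>
     a 1 * char_fun \<alpha> \<beta> lam = 0 \<and>
     (\<forall>k\<ge>2. a k * char_fun \<alpha> \<beta> (lam ^ k) =
        fps_nth (fps_subst2 b (fps_of_coeffs a) (fps_scale lam (fps_of_coeffs a))) k)"
proof -
  define U where "U = fps_of_coeffs a"
  define G where "G = fps_subst2 b U (fps_scale lam U)"
  have G0: "fps_nth G k = 0" if "k < 2" for k
  proof -
    have "{(i, j). 2 \<le> i + j \<and> i + j \<le> k} = {}" using that by auto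
    then show ?thesis unfolding G_def fps_subst2_def by (simp only: fps_nth_Abs_fps sum.empty)
  qed
  have U: "fps_nth U k = (if k = 0 then 0 else a k)" for k
    by (simp add: U_def fps_of_coeffs_def)
  have sc: "fps_nth (fps_scale c U) k = c ^ k * fps_nth U k" for c k
    by (simp add: fps_scale_def fps_compose_linear)
  have coeff: "fps_nth (fps_scale (lam ^ 2) U) k =
        fps_nth (- fps_const \<beta> * U - fps_const \<alpha> * fps_scale lam U + G) k \<longleftrightarrow>
      fps_nth U k * char_fun \<alpha> \<beta> (lam ^ k) = fps_nth G k" for k
  proof -
    have "fps_nth U k * char_fun \<alpha> \<beta> (lam ^ k) - fps_nth G k =
        fps_nth (fps_scale (lam ^ 2) U) k -
        fps_nth (- fps_const \<beta> * U - fps_const \<alpha> * fps_scale lam U + G) k"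
      by (simp add: sc char_fun_def algebra_simps flip: power_mult fps_const_neg)
    then show ?thesis
      by (metis eq_iff_diff_eq_0)
  qed
  have "formal_solution \<alpha> \<beta> b lam a \<longleftrightarrow>
      (\<forall>k. fps_nth U k * char_fun \<alpha> \<beta> (lam ^ k) = fps_nth G k)"
    unfolding formal_solution_def Let_def fps_eq_iff
    using coeff by (simp only: U_def G_def)
  also have "\<dots> \<longleftrightarrow> a 1 * char_fun \<alpha> \<beta> lam = 0 \<and>
      (\<forall>k\<ge>2. a k * char_fun \<alpha> \<beta> (lam ^ k) = fps_nth G k)" (is "?L \<longleftrightarrow> ?R")
  proof
    assume L: ?L
    have "fps_nth U 1 * char_fun \<alpha> \<beta> (lam ^ 1) = fps_nth G 1"
      using L by blast
    then have "a 1 * char_fun \<alpha> \<beta> lam = 0"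
      by (simp add: U G0)
    moreover have "a k * char_fun \<alpha> \<beta> (lam ^ k) = fps_nth G k" if "k \<ge> 2" for k
      using L that by (metis U not_numeral_le_zero)
    ultimately show ?R by blast
  next
    assume R: ?R
    have "fps_nth U k * char_fun \<alpha> \<beta> (lam ^ k) = fps_nth G k" for k
    proof -
      consider "k = 0" | "k = 1" | "k \<ge> 2" by linarith
      then show ?thesis
        using R by cases (auto simp: U G0)
    qed
    then show ?L by blast
  qed
  finally show ?thesis
    by (simp only: U_def G_def)
qed

text \<open>The argument \<open>L\<close> is the chosen value of \<open>log \<lambda>\<close>, so that \<open>\<lambda>\<^sup>t\<close> is \<open>exp (t * L)\<close>.\<close>

definition soln_region :: "complex \<Rightarrow> real \<Rightarrow> complex set" where
  "soln_region L \<eta> = {t. norm (exp (t * L)) < \<eta>}"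

definition holomorphic_solution ::
    "(complex \<Rightarrow> complex \<Rightarrow> complex) \<Rightarrow> complex set \<Rightarrow> (complex \<Rightarrow> complex) \<Rightarrow> bool" where
  "holomorphic_solution f S u \<longleftrightarrow>
     u holomorphic_on S \<and>
     (\<forall>t. t \<in> S \<and> t + 1 \<in> S \<and> t + 2 \<in> S \<longrightarrow> u (t + 2) = f (u t) (u (t + 1)))"

end

theory Submission
  imports Defs
begin

text \<open>The coefficients obey \<open>|a\<^sub>n| \<le> \<epsilon> s\<^sup>n / n\<^sup>2\<close>, by Cauchy's method of majorants. The weight
  \<open>1 / n\<^sup>2\<close> is, up to a factor \<open>8\<close>, stable under convolution, so for \<open>i + j \<ge> 2\<close> the product
  \<open>U(\<tau>)\<^sup>i U(\<lambda>\<tau>)\<^sup>j\<close> has coefficients at most \<open>8 \<epsilon>\<^sup>2 (s M)\<^sup>n / n\<^sup>2\<close> with \<open>M = max 1 |\<lambda>|\<close>. Since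
  \<open>M\<^sup>n / |D(\<lambda>\<^sup>n)|\<close> is bounded, the quadratic gain in a small \<open>\<epsilon>\<close> absorbs all constants, and
  \<open>s = |a\<^sub>1| / \<epsilon>\<close> takes care of \<open>a\<^sub>1\<close>. The same estimate justifies the rearrangement that turns the
  formal identity into the functional equation for \<open>|\<tau>| < 1 / (s M)\<close>.\<close>

section \<open>Majorant calculus: the weight 1/n^2 and products of bounded power series\<close>

lemma sum_inverse_squares_le: "(\<Sum>i=0..n. 1 / (real i)\<^sup>2) \<le> 2"
proof -
  \<comment> \<open>The induction closes only for the sharper bound with
    \<open>1 / real (Suc n)\<close> subtracted, which telescopes. The term \<open>i = 0\<close> is
    0, because division by zero yields 0.\<close>
  have "(\<Sum>i=0..Suc n. 1 / (real i)\<^sup>2) \<le> 2 - 1 / real (Suc n)" for n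
  proof (induction n)
    case (Suc n)
    have "1 / (real (Suc (Suc n)))\<^sup>2 \<le> 1 / (real (Suc n) * real (Suc (Suc n)))"
      by (intro divide_left_mono) (auto simp: power2_eq_square)
    also have "\<dots> = 1 / real (Suc n) - 1 / real (Suc (Suc n))"
      by (simp add: field_simps)
    finally show ?case using Suc by simp
  qed simp
  from this[of n] show ?thesis
    by (smt (verit) of_nat_0_le_iff sum.atLeast0_atMost_Suc zero_le_divide_1_iff zero_le_power2)
qed

text \<open>With x + y = n, the inequality (x + y)^2 \<le> 2 (x^2 + y^2) bounds 1/(x^2 y^2) by
  (2/n^2) (1/x^2 + 1/y^2). Each of the two resulting sums is at most 2, whence the 8. The end terms
  are 0, again by 1/0 = 0.\<close>

lemma convolution_inverse_squares_le:
  "(\<Sum>i=0..n. 1 / (real i)\<^sup>2 * (1 / (real (n - i))\<^sup>2)) \<le> 8 / (real n)\<^sup>2"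
proof (cases "n = 0")
  case False
  have "1 / (real i)\<^sup>2 * (1 / (real (n - i))\<^sup>2)
      \<le> 2 / (real n)\<^sup>2 * (1 / (real i)\<^sup>2 + 1 / (real (n - i))\<^sup>2)" if "i \<in> {0..n}" for i
  proof (cases "i = 0 \<or> i = n")
    case False
    define x y where "x = real i" and "y = real (n - i)"
    have xy: "x > 0" "y > 0" and n: "real n = x + y"
      using that False by (auto simp: x_def y_def of_nat_diff)
    have "(x + y)\<^sup>2 \<le> 2 * (x\<^sup>2 + y\<^sup>2)"
      using sum_squares_bound[of x y] by (simp add: power2_sum)
    then have "1 / x\<^sup>2 * (1 / y\<^sup>2) \<le> 2 / (x + y)\<^sup>2 * (1 / x\<^sup>2 + 1 / y\<^sup>2)"
      using xy by (simp add: divide_simps)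
    then show ?thesis by (simp add: n flip: x_def y_def)
  qed auto
  then have "(\<Sum>i=0..n. 1 / (real i)\<^sup>2 * (1 / (real (n - i))\<^sup>2))
      \<le> (\<Sum>i=0..n. 2 / (real n)\<^sup>2 * (1 / (real i)\<^sup>2 + 1 / (real (n - i))\<^sup>2))"
    by (rule sum_mono)
  also have "\<dots> = 2 / (real n)\<^sup>2 * ((\<Sum>i=0..n. 1 / (real i)\<^sup>2) + (\<Sum>i=0..n. 1 / (real (n - i))\<^sup>2))"
    by (simp only: sum.distrib flip: sum_distrib_left)
  also have "(\<Sum>i=0..n. 1 / (real (n - i))\<^sup>2) = (\<Sum>i=0..n. 1 / (real i)\<^sup>2)"
    by (subst sum.atLeastAtMost_rev) simp
  also have "2 / (real n)\<^sup>2 * ((\<Sum>i=0..n. 1 / (real i)\<^sup>2) + (\<Sum>i=0..n. 1 / (real i)\<^sup>2))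
      \<le> 2 / (real n)\<^sup>2 * 4"
    using sum_inverse_squares_le[of n] by (intro mult_left_mono) auto
  finally show ?thesis by simp
qed simp

text \<open>At \<open>n = 0\<close> the right-hand side is \<open>0\<close>, so the constant term vanishes.\<close>

definition coeffs_bounded :: "real \<Rightarrow> real \<Rightarrow> nat \<Rightarrow> complex fps \<Rightarrow> bool" where
  "coeffs_bounded \<sigma> c N P \<longleftrightarrow> (\<forall>n\<le>N. norm (fps_nth P n) \<le> c * \<sigma> ^ n / (real n)\<^sup>2)"

lemma coeffs_bounded_0: "coeffs_bounded \<sigma> c N P \<Longrightarrow> fps_nth P 0 = 0"
  by (auto simp: coeffs_bounded_def dest: spec[of _ 0])

lemma coeffs_bounded_mono:
  "coeffs_bounded \<sigma> c N P \<Longrightarrow> c \<le> d \<Longrightarrow> M \<le> N \<Longrightarrow> 0 \<le> \<sigma> \<Longrightarrow> coeffs_bounded \<sigma> d M P"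
  unfolding coeffs_bounded_def
  by (meson divide_right_mono mult_right_mono order_trans zero_le_power zero_le_power2)

text \<open>One coefficient is gained because neither factor has a constant term.\<close>

lemma coeffs_bounded_mult:
  assumes P: "coeffs_bounded \<sigma> c N P" and Q: "coeffs_bounded \<sigma> d N Q"
    and nonneg: "0 \<le> \<sigma>" "0 \<le> c" "0 \<le> d"
  shows "coeffs_bounded \<sigma> (8 * c * d) (Suc N) (P * Q)"
  unfolding coeffs_bounded_def
proof (intro allI impI)
  fix n assume n: "n \<le> Suc N"
  have term_le: "norm (fps_nth P i * fps_nth Q (n - i))
      \<le> c * d * \<sigma> ^ n * (1 / (real i)\<^sup>2 * (1 / (real (n - i))\<^sup>2))" if i: "i \<in> {0..n}" for i
  proof (cases "i = 0 \<or> i = n")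
    case True
    then show ?thesis using coeffs_bounded_0[OF P] coeffs_bounded_0[OF Q] by auto
  next
    case False
    then have "i \<le> N" "n - i \<le> N" using i n by auto
    then have "norm (fps_nth P i * fps_nth Q (n - i))
        \<le> (c * \<sigma> ^ i / (real i)\<^sup>2) * (d * \<sigma> ^ (n - i) / (real (n - i))\<^sup>2)"
      using P Q nonneg unfolding norm_mult coeffs_bounded_def by (intro mult_mono) auto
    also have "\<dots> = c * d * (\<sigma> ^ i * \<sigma> ^ (n - i)) * (1 / (real i)\<^sup>2 * (1 / (real (n - i))\<^sup>2))"
      by simp
    also have "\<sigma> ^ i * \<sigma> ^ (n - i) = \<sigma> ^ n" using i by (simp flip: power_add)
    finally show ?thesis .
  qed
  have "norm (fps_nth (P * Q) n) \<le> (\<Sum>i=0..n. norm (fps_nth P i * fps_nth Q (n - i)))"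
    unfolding fps_mult_nth by (rule norm_sum)
  also have "\<dots> \<le> (\<Sum>i=0..n. c * d * \<sigma> ^ n * (1 / (real i)\<^sup>2 * (1 / (real (n - i))\<^sup>2)))"
    using term_le by (rule sum_mono)
  also have "\<dots> = c * d * \<sigma> ^ n * (\<Sum>i=0..n. 1 / (real i)\<^sup>2 * (1 / (real (n - i))\<^sup>2))"
    by (simp only: sum_distrib_left)
  also have "\<dots> \<le> c * d * \<sigma> ^ n * (8 / (real n)\<^sup>2)"
    using nonneg by (intro mult_left_mono convolution_inverse_squares_le) auto
  finally show "norm (fps_nth (P * Q) n) \<le> 8 * c * d * \<sigma> ^ n / (real n)\<^sup>2" by (simp add: mult_ac)
qed

text \<open>Peeling off one factor of either kind makes the total degree the induction variable for
  mixed powers.\<close>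

lemma mixed_power_factor:
  fixes U V :: "'a::comm_semiring_1"
  assumes "i + j = Suc m"
  obtains W i' j' where "W = U \<or> W = V" "i' + j' = m" "U ^ i * V ^ j = W * (U ^ i' * V ^ j')"
proof (cases i)
  case 0
  then show ?thesis using assms that[of V 0 m] by simp
next
  case (Suc i')
  then show ?thesis using assms that[of U i' j] by (simp add: mult_ac)
qed

text \<open>Under \<open>8 * c \<le> 1\<close> the bound is stable under products, since 8 c^2 \<le>
  c. Omitting this weakening for the last product keeps both the quadratic gain and the extra
  coefficient that the recurrence requires.\<close>

lemma coeffs_bounded_mixed_power:
  assumes U: "coeffs_bounded \<sigma> c N U" and V: "coeffs_bounded \<sigma> c N V"
    and c: "0 \<le> c" "8 * c \<le> 1" and \<sigma>: "0 \<le> \<sigma>"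
  shows "1 \<le> i + j \<Longrightarrow> coeffs_bounded \<sigma> c N (U ^ i * V ^ j)"
    and "2 \<le> i + j \<Longrightarrow> coeffs_bounded \<sigma> (8 * c * c) (Suc N) (U ^ i * V ^ j)"
proof -
  have step: "coeffs_bounded \<sigma> (8 * c * c) (Suc N) (U ^ i * V ^ j)"
    if ij: "i + j = Suc m"
      and hyp: "\<And>i j. i + j = m \<Longrightarrow> coeffs_bounded \<sigma> c N (U ^ i * V ^ j)" for i j m
    using mixed_power_factor[OF ij, of U V] U V hyp coeffs_bounded_mult[OF _ _ \<sigma> c(1) c(1)]
    by metis
  have low: "coeffs_bounded \<sigma> c N (U ^ i * V ^ j)" if "i + j = Suc m" for i j m
    using that
  proof (induction m arbitrary: i j)
    case 0
    then consider "i = 1 \<and> j = 0" | "i = 0 \<and> j = 1" by linarith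
    then show ?case using U V by cases auto
  next
    case (Suc m)
    have "8 * c * c \<le> c" using mult_right_mono[OF c(2) c(1)] by simp
    then show ?case
      using step[OF Suc.prems Suc.IH] \<sigma> by (auto intro: coeffs_bounded_mono)
  qed
  show "1 \<le> i + j \<Longrightarrow> coeffs_bounded \<sigma> c N (U ^ i * V ^ j)"
    using low[of i j "i + j - 1"] by simp
  show "2 \<le> i + j \<Longrightarrow> coeffs_bounded \<sigma> (8 * c * c) (Suc N) (U ^ i * V ^ j)"
    using step[of i j "Suc (i + j - 2)"] low[of _ _ "i + j - 2"] by simp
qed

lemma fps_nth_scale: "fps_nth (fps_scale c U) n = c ^ n * fps_nth U n"
  by (simp add: fps_scale_def fps_compose_linear)

lemma fps_scale_1: "fps_scale 1 U = U"
  by (simp add: fps_eq_iff fps_nth_scale)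

text \<open>Rescaling multiplies the n-th coefficient by z^n, so it affects only the growth rate.
  Allowing any bound \<open>M\<close> on |z| lets U(\<tau>) and U(\<lambda>\<tau>) share one
  rate.\<close>

lemma coeffs_bounded_scale:
  assumes U: "coeffs_bounded s c N U" and M: "norm z \<le> M" and nonneg: "0 \<le> s" "0 \<le> c"
  shows "coeffs_bounded (s * M) c N (fps_scale z U)"
  unfolding coeffs_bounded_def
proof (intro allI impI)
  have "M \<ge> 0" using M norm_ge_zero[of z] by linarith
  fix n assume "n \<le> N"
  with \<open>M \<ge> 0\<close> have "norm (fps_nth (fps_scale z U) n) \<le> M ^ n * (c * s ^ n / (real n)\<^sup>2)"
    using U M nonneg unfolding fps_nth_scale norm_mult norm_power coeffs_bounded_def
    by (intro mult_mono power_mono) auto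
  then show "norm (fps_nth (fps_scale z U) n) \<le> c * (s * M) ^ n / (real n)\<^sup>2"
    by (simp add: power_mult_distrib mult_ac)
qed

section \<open>Lower bound for the divisors D(\<lambda>^k)\<close>

text \<open>As |\<lambda>| differs from 1, \<lambda>^k tends either to 0, where D tends to \<beta>
  \<noteq> 0, or to infinity, where D(z) grows like z^2. In both cases the quotients converge and
  hence are bounded. The numerator is the growth that U(\<lambda>\<tau>) brings into the
  recurrence.\<close>

lemma norm_char_fun_power_ge:
  assumes \<beta>: "\<beta> \<noteq> 0" and lam: "norm lam \<noteq> 1"
    and nz: "\<And>k. k \<ge> 2 \<Longrightarrow> char_fun \<alpha> \<beta> (lam ^ k) \<noteq> 0"
  obtains K where "K > 0"
    "\<And>k. k \<ge> 2 \<Longrightarrow> max 1 (norm lam) ^ k \<le> K * norm (char_fun \<alpha> \<beta> (lam ^ k))"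
proof -
  define q where "q k = max 1 (norm lam) ^ k / norm (char_fun \<alpha> \<beta> (lam ^ k))" for k
  have "convergent q"
  proof (cases "norm lam < 1")
    case True
    then have "(\<lambda>k. 1 / norm (char_fun \<alpha> \<beta> (lam ^ k))) \<longlonglongrightarrow> 1 / norm (0 ^ 2 + \<alpha> * 0 + \<beta>)"
      unfolding char_fun_def using \<beta> True by (intro tendsto_intros) auto
    moreover have "q = (\<lambda>k. 1 / norm (char_fun \<alpha> \<beta> (lam ^ k)))"
      using True by (simp add: q_def max_absorb1 fun_eq_iff)
    ultimately show ?thesis by (auto simp: convergent_def)
  next
    case False
    \<comment> \<open>The substitution y = 1/x moves infinity to 0: the quotient becomes |y| / |1 +
      \<alpha> y + \<beta> y^2| at y = \<open>\<mu> ^ k\<close>, which tends to 0.\<close>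
    have reciprocal: "x\<^sup>2 + \<alpha> * x + \<beta> = x\<^sup>2 * (1 + \<alpha> * y + \<beta> * y\<^sup>2)" if "x * y = 1" for x y
      using that by algebra
    define \<mu> where "\<mu> = inverse lam"
    have "norm \<mu> < 1" "lam \<noteq> 0" using False lam by (auto simp: \<mu>_def norm_inverse inverse_less_1_iff)
    then have "(\<lambda>k. norm (\<mu> ^ k) / norm (1 + \<alpha> * \<mu> ^ k + \<beta> * (\<mu> ^ k)\<^sup>2))
        \<longlonglongrightarrow> norm (0::complex) / norm (1 + \<alpha> * 0 + \<beta> * 0\<^sup>2)"
      by (intro tendsto_intros) auto
    moreover have "q = (\<lambda>k. norm (\<mu> ^ k) / norm (1 + \<alpha> * \<mu> ^ k + \<beta> * (\<mu> ^ k)\<^sup>2))"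
    proof
      fix k
      have inv: "lam ^ k * \<mu> ^ k = 1"
        using \<open>lam \<noteq> 0\<close> by (simp add: \<mu>_def flip: power_mult_distrib)
      have "norm (char_fun \<alpha> \<beta> (lam ^ k))
          = norm (lam ^ k) * norm (lam ^ k) * norm (1 + \<alpha> * \<mu> ^ k + \<beta> * (\<mu> ^ k)\<^sup>2)"
        unfolding char_fun_def reciprocal[OF inv]
        by (simp only: norm_mult power2_eq_square[of "lam ^ k"])
      moreover have "max 1 (norm lam) ^ k = norm (lam ^ k)" using False by (simp add: norm_power)
      ultimately have "q k = 1 / norm (lam ^ k) / norm (1 + \<alpha> * \<mu> ^ k + \<beta> * (\<mu> ^ k)\<^sup>2)"
        using \<open>lam \<noteq> 0\<close> by (simp add: q_def)
      also have "1 / norm (lam ^ k) = norm (\<mu> ^ k)"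
        by (simp add: \<mu>_def norm_inverse norm_power power_inverse divide_inverse)
      finally show "q k = norm (\<mu> ^ k) / norm (1 + \<alpha> * \<mu> ^ k + \<beta> * (\<mu> ^ k)\<^sup>2)" .
    qed
    ultimately show ?thesis by (auto simp: convergent_def)
  qed
  then obtain K where K: "K > 0" "\<And>k. norm (q k) \<le> K"
    using convergent_imp_Bseq by (metis BseqE)
  have "max 1 (norm lam) ^ k \<le> K * norm (char_fun \<alpha> \<beta> (lam ^ k))" if "k \<ge> 2" for k
  proof -
    \<comment> \<open>Nonvanishing of D allows the denominator to be cleared; at a zero of D,
      \<open>q k\<close> would be 0 by convention and carry no information.\<close>
    have "q k \<le> K" using K(2)[of k] by simp
    then show ?thesis using nz[OF that] by (simp add: q_def field_simps)
  qed
  with K(1) that show ?thesis by blast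
qed

section \<open>Geometric bounds for the formal coefficients\<close>

text \<open>Induction on the truncation order: coefficient N + 1 of g(U(\<tau>), U(\<lambda>\<tau>))
  comes from products of degree at least 2, which the bounds up to N already control. The condition
  \<open>8 * K * B * \<epsilon> \<le> 1\<close> turns the resulting constant back into
  \<open>\<epsilon>\<close>.\<close>

lemma formal_solution_coeffs_bounded:
  assumes formal: "formal_solution \<alpha> \<beta> b lam a"
    and K: "K > 0" "\<And>k. k \<ge> 2 \<Longrightarrow> max 1 (norm lam) ^ k \<le> K * norm (char_fun \<alpha> \<beta> (lam ^ k))"
    and B: "\<And>F. finite F \<Longrightarrow> F \<subseteq> {(i, j). i + j \<ge> 2} \<Longrightarrow> (\<Sum>(i, j)\<in>F. norm (b i j)) \<le> B"
    and \<epsilon>: "\<epsilon> > 0" "8 * \<epsilon> \<le> 1" "8 * K * B * \<epsilon> \<le> 1" and s: "s \<ge> 0" and a1: "norm (a 1) \<le> \<epsilon> * s"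
  shows "coeffs_bounded s \<epsilon> N (fps_of_coeffs a)"
proof (induction N)
  case 0
  show ?case by (simp add: coeffs_bounded_def fps_of_coeffs_def)
next
  case (Suc N)
  define M where "M = max 1 (norm lam)"
  define U where "U = fps_of_coeffs a"
  define V where "V = fps_scale lam U"
  define k where "k = Suc N"
  have M: "M \<ge> 1" by (simp add: M_def)
  have "norm (a k) \<le> \<epsilon> * s ^ k / (real k)\<^sup>2"
  \<comment> \<open>The recurrence is used for k \<ge> 2; at k = 1 the bound is the assumption on
    \<open>a 1\<close>.\<close>
  proof (cases "k = 1")
    case True
    then show ?thesis using a1 by simp
  next
    case False
    then have k2: "k \<ge> 2" by (simp add: k_def)
    \<comment> \<open>Viewing U as its own rescaling by 1 raises its rate to the
      \<open>s * M\<close> shared with V.\<close>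
    have U: "coeffs_bounded (s * M) \<epsilon> N U"
      using coeffs_bounded_scale[OF Suc.IH, of 1 M] M s \<epsilon> by (simp add: U_def fps_scale_1)
    have V: "coeffs_bounded (s * M) \<epsilon> N V"
      unfolding V_def U_def using Suc.IH s \<epsilon> by (intro coeffs_bounded_scale) (auto simp: M_def)
    have P: "norm (fps_nth (U ^ i * V ^ j) k) \<le> 8 * \<epsilon> * \<epsilon> * (s * M) ^ k / (real k)\<^sup>2"
      if "2 \<le> i + j" for i j
      using coeffs_bounded_mixed_power(2)[OF U V _ _ _ that] \<epsilon> s M
      by (auto simp: coeffs_bounded_def k_def)
    define F where "F = {(i, j). 2 \<le> i + j \<and> i + j \<le> k}"
    have "F \<subseteq> {..k} \<times> {..k}" by (auto simp: F_def)
    then have F: "finite F" by (rule finite_subset) auto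
    have "norm (a k) * norm (char_fun \<alpha> \<beta> (lam ^ k))
        = norm (\<Sum>(i, j)\<in>F. b i j * fps_nth (U ^ i * V ^ j) k)"
      using formal k2 unfolding formal_solution_iff_recurrence
      by (simp add: F_def fps_subst2_def U_def V_def flip: norm_mult)
    also have "\<dots> \<le> (\<Sum>(i, j)\<in>F. norm (b i j) * (8 * \<epsilon> * \<epsilon> * (s * M) ^ k / (real k)\<^sup>2))"
      using P by (intro sum_norm_le)
        (auto simp: F_def norm_mult simp del: times_divide_eq_right intro!: mult_left_mono)
    also have "\<dots> = (\<Sum>(i, j)\<in>F. norm (b i j)) * (8 * \<epsilon> * \<epsilon> * (s * M) ^ k / (real k)\<^sup>2)"
      by (simp only: sum_distrib_right case_prod_unfold)
    also have "\<dots> \<le> B * (8 * \<epsilon> * \<epsilon> * (s * M) ^ k / (real k)\<^sup>2)"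
      using B[OF F] \<epsilon> s M by (intro mult_right_mono) (auto simp: F_def)
    finally have D: "norm (a k) * norm (char_fun \<alpha> \<beta> (lam ^ k))
        \<le> B * (8 * \<epsilon> * \<epsilon> * (s * M) ^ k / (real k)\<^sup>2)" .
    \<comment> \<open>The \<open>M ^ k\<close> gained from the divisor bound cancels the one in
      \<open>(s * M) ^ k\<close>, so the rate returns to \<open>s\<close>.\<close>
    have "norm (a k) * M ^ k \<le> norm (a k) * (K * norm (char_fun \<alpha> \<beta> (lam ^ k)))"
      using K(2)[OF k2] by (intro mult_left_mono) (auto simp: M_def)
    also have "\<dots> = K * (norm (a k) * norm (char_fun \<alpha> \<beta> (lam ^ k)))" by simp
    also have "\<dots> \<le> K * (B * (8 * \<epsilon> * \<epsilon> * (s * M) ^ k / (real k)\<^sup>2))"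
      using D K(1) by (intro mult_left_mono) auto
    also have "\<dots> = (8 * K * B * \<epsilon>) * (\<epsilon> * (s * M) ^ k / (real k)\<^sup>2)" by (simp add: mult_ac)
    also have "\<dots> \<le> 1 * (\<epsilon> * (s * M) ^ k / (real k)\<^sup>2)"
      using \<epsilon> s M by (intro mult_right_mono) auto
    also have "\<dots> = (\<epsilon> * s ^ k / (real k)\<^sup>2) * M ^ k" by (simp add: power_mult_distrib)
    finally show ?thesis by (rule mult_right_le_imp_le) (use M in simp)
  qed
  then show ?case
    using Suc.IH by (auto simp: coeffs_bounded_def le_Suc_eq k_def fps_of_coeffs_def)
qed

section \<open>Convergence and rearrangement of the double series\<close>

lemma coeffs_bounded_norm_le:
  assumes "\<And>N. coeffs_bounded \<sigma> c N P" "0 \<le> \<sigma>" "0 \<le> c"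
  shows "norm (fps_nth P n) \<le> c * \<sigma> ^ n"
proof (cases "n = 0")
  case True
  then show ?thesis using coeffs_bounded_0[OF assms(1)] assms by simp
next
  case False
  have "norm (fps_nth P n) \<le> c * \<sigma> ^ n / (real n)\<^sup>2"
    using assms(1)[of n] by (simp add: coeffs_bounded_def)
  also have "\<dots> \<le> c * \<sigma> ^ n / 1"
    using assms False by (intro divide_left_mono) (auto simp: one_le_power)
  finally show ?thesis by simp
qed

lemma fps_conv_radius_ge_of_norm_le:
  assumes "\<And>n. norm (fps_nth P n) \<le> c * \<sigma> ^ n" "\<sigma> > 0"
  shows "fps_conv_radius P \<ge> ereal (1 / \<sigma>)"
  unfolding fps_conv_radius_def
proof (rule conv_radius_geI_ex)
  fix r :: real assume r: "0 < r" "ereal r < ereal (1 / \<sigma>)"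
  then have "summable (\<lambda>n. c * (\<sigma> * r) ^ n)"
    using assms by (intro summable_mult summable_geometric) (auto simp: field_simps)
  moreover have "norm (fps_nth P n * of_real r ^ n) \<le> c * (\<sigma> * r) ^ n" for n
    using mult_right_mono[OF assms(1)[of n], of "r ^ n"] r
    by (simp add: norm_mult norm_power power_mult_distrib mult_ac)
  ultimately have "summable (\<lambda>n. fps_nth P n * of_real r ^ n)"
    by (rule summable_comparison_test')
  then show "\<exists>z. norm z = r \<and> summable (\<lambda>n. fps_nth P n * z ^ n)"
    using r by (intro exI[of _ "of_real r"]) auto
qed

text \<open>In each term of the Cauchy product one index lies below the order of its factor. Hence
  the truncation in \<open>fps_subst2\<close> drops only zero terms.\<close>

lemma fps_nth_mixed_power_eq_0:
  fixes U V :: "complex fps"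
  assumes "fps_nth U 0 = 0" "fps_nth V 0 = 0" "n < i + j"
  shows "fps_nth (U ^ i * V ^ j) n = 0"
  unfolding fps_mult_nth
proof (rule sum.neutral, rule ballI)
  fix l assume "l \<in> {0..n}"
  then have "l < i \<or> n - l < j" using assms by auto
  then show "fps_nth (U ^ i) l * fps_nth (V ^ j) (n - l) = 0"
    using assms startsby_zero_power_prefix by (metis mult_zero_left mult_zero_right)
qed

lemma eval_fps_sums: "ereal (norm z) < fps_conv_radius P \<Longrightarrow> (\<lambda>n. fps_nth P n * z ^ n) sums eval_fps P z"
  for z :: complex
  unfolding eval_fps_def using summable_fps[of z P] by (simp add: summable_sums)

lemma fps_subst2_sums:
  assumes g: "((\<lambda>(i, j). b i j * eval_fps U z ^ i * eval_fps V z ^ j) has_sum S) {(i, j). i + j \<ge> 2}"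
    and b: "(\<lambda>(i, j). norm (b i j)) summable_on {(i, j). i + j \<ge> 2}"
    and U: "\<And>N. coeffs_bounded \<sigma> c N U" and V: "\<And>N. coeffs_bounded \<sigma> c N V"
    and c: "0 \<le> c" "8 * c \<le> 1" and \<sigma>: "0 < \<sigma>" and z: "norm z < 1 / \<sigma>"
  shows "(\<lambda>n. fps_nth (fps_subst2 b U V) n * z ^ n) sums S"
proof -
  define I where "I = {(i, j). i + j \<ge> (2::nat)}"
  define P where "P p = U ^ fst p * V ^ snd p" for p
  define h where "h p n = b (fst p) (snd p) * fps_nth (P p) n * z ^ n" for p n
  have radius: "ereal (norm z) < fps_conv_radius Q" if "\<And>N. coeffs_bounded \<sigma> c N Q" for Q
    using fps_conv_radius_ge_of_norm_le[OF coeffs_bounded_norm_le[OF that]] \<sigma> c z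
    by (smt (verit) ereal_less_eq(3) less_ereal.simps(1) less_le_trans)
  have P: "coeffs_bounded \<sigma> c N (P p)" if "p \<in> I" for p N
    using that U V c \<sigma> unfolding P_def
    by (intro coeffs_bounded_mixed_power(1)) (auto simp: I_def)
  have geom_summable: "summable (\<lambda>n. c * (\<sigma> * norm z) ^ n)"
    using z \<sigma> by (intro summable_mult summable_geometric) (auto simp: field_simps)
  then have geom: "(\<lambda>n. c * (\<sigma> * norm z) ^ n) summable_on UNIV"
    using c \<sigma> by (intro summable_nonneg_imp_summable_on) auto
  have "(\<lambda>(p, n). norm (b (fst p) (snd p)) * (c * (\<sigma> * norm z) ^ n)) summable_on I \<times> UNIV"
    using b geom c \<sigma> unfolding I_def[symmetric]
    by (intro summable_on_SigmaI[where g = "\<lambda>p. norm (b (fst p) (snd p)) * (\<Sum>\<^sub>\<infinity>n. c * (\<sigma> * norm z) ^ n)"]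
        summable_on_cmult_left)
      (auto simp: case_prod_unfold intro!: has_sum_cmult_right[OF has_sum_infsum[OF geom]])
  moreover have h_le: "norm (h p n) \<le> norm (b (fst p) (snd p)) * (c * (\<sigma> * norm z) ^ n)"
    if "p \<in> I" for p n
  proof -
    have "norm (fps_nth (P p) n) * norm z ^ n \<le> c * \<sigma> ^ n * norm z ^ n"
      using coeffs_bounded_norm_le[OF P[OF that], of n] \<sigma> c by (intro mult_right_mono) auto
    then show ?thesis
      unfolding h_def norm_mult norm_power power_mult_distrib mult.assoc
      by (intro mult_left_mono) auto
  qed
  ultimately have "(\<lambda>(p, n). norm (h p n)) summable_on I \<times> UNIV"
    by (rule_tac summable_on_comparison_test) auto
  then have sum: "(\<lambda>(p, n). h p n) summable_on I \<times> UNIV"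
    by (rule_tac abs_summable_summable) (simp add: case_prod_unfold)
  have inner: "((\<lambda>n. h p n) has_sum b (fst p) (snd p) * eval_fps U z ^ fst p * eval_fps V z ^ snd p) UNIV"
    if p: "p \<in> I" for p
  proof -
    have "eval_fps (P p) z = eval_fps U z ^ fst p * eval_fps V z ^ snd p"
      unfolding P_def using radius[OF U] radius[OF V]
      by (subst eval_fps_mult)
         (auto simp: eval_fps_power intro: less_le_trans[OF _ fps_conv_radius_power])
    moreover have "(\<lambda>n. h p n) sums (b (fst p) (snd p) * eval_fps (P p) z)"
      unfolding h_def mult.assoc by (intro sums_mult eval_fps_sums radius P p)
    moreover have "summable (\<lambda>n. norm (h p n))"
      using h_le[OF p] by (intro summable_comparison_test'[OF summable_mult[OF geom_summable]]) auto
    ultimately show ?thesis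
      by (simp add: norm_summable_imp_has_sum mult.assoc)
  qed
  have "((\<lambda>(p, n). h p n) has_sum S) (I \<times> UNIV)"
    using g inner sum unfolding I_def[symmetric]
    by (intro has_sum_SigmaI[where g = "\<lambda>p. b (fst p) (snd p) * eval_fps U z ^ fst p * eval_fps V z ^ snd p"])
      (auto simp: case_prod_unfold)
  then have swapped: "((\<lambda>(n, p). h p n) has_sum S) (UNIV \<times> I)"
    by (subst (asm) has_sum_swap) simp
  have "((\<lambda>p. h p n) has_sum fps_nth (fps_subst2 b U V) n * z ^ n) I" for n
  proof -
    define F where "F = {(i, j). 2 \<le> i + j \<and> i + j \<le> n}"
    have "F \<subseteq> {..n} \<times> {..n}" by (auto simp: F_def)
    then have F: "finite F" by (rule finite_subset) auto
    have "(\<Sum>p\<in>F. h p n) = fps_nth (fps_subst2 b U V) n * z ^ n"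
      by (simp add: fps_subst2_def F_def h_def P_def sum_distrib_right case_prod_unfold)
    then have "((\<lambda>p. h p n) has_sum fps_nth (fps_subst2 b U V) n * z ^ n) F"
      using F by (metis has_sum_finite)
    then show ?thesis
      by (rule has_sum_cong_neutral[THEN iffD1, rotated -1])
        (auto simp: F_def I_def h_def P_def fps_nth_mixed_power_eq_0
           coeffs_bounded_0[OF U] coeffs_bounded_0[OF V])
  qed
  then have "((\<lambda>n. fps_nth (fps_subst2 b U V) n * z ^ n) has_sum S) UNIV"
    using has_sum_SigmaD[OF swapped] by (simp add: case_prod_unfold)
  then show ?thesis by (rule has_sum_imp_sums)
qed

lemma eval_fps_scale: "eval_fps (fps_scale c U) z = eval_fps U (c * z)"
  by (simp add: eval_fps_def fps_nth_scale power_mult_distrib mult_ac)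

lemma power_series2_coeffs_abs_summable:
  fixes b :: "nat \<Rightarrow> nat \<Rightarrow> complex"
  assumes "\<And>x y. ((\<lambda>(i, j). b i j * x ^ i * y ^ j) has_sum g x y) A"
  shows "(\<lambda>(i, j). norm (b i j)) summable_on A"
proof -
  have "(\<lambda>(i, j). b i j) summable_on A"
    using assms[of 1 1] by (auto simp: summable_on_def)
  then show ?thesis
    by (simp add: summable_on_iff_abs_summable_on_complex case_prod_unfold)
qed

lemma formal_solution_functional_equation:
  fixes g :: "complex \<Rightarrow> complex \<Rightarrow> complex" and a :: "nat \<Rightarrow> complex"
  defines "U \<equiv> fps_of_coeffs a"
  assumes formal: "formal_solution \<alpha> \<beta> b lam a"
    and g: "\<And>x y. ((\<lambda>(i, j). b i j * x ^ i * y ^ j) has_sum g x y) {(i, j). i + j \<ge> 2}"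
    and U: "\<And>N. coeffs_bounded s \<epsilon> N U" and \<epsilon>: "0 \<le> \<epsilon>" "8 * \<epsilon> \<le> 1" and s: "s > 0"
    and z: "norm z < 1 / (s * max 1 (norm lam))"
    and z2: "norm (lam\<^sup>2 * z) < 1 / (s * max 1 (norm lam))"
  shows "eval_fps U (lam\<^sup>2 * z)
    = - \<beta> * eval_fps U z - \<alpha> * eval_fps U (lam * z) + g (eval_fps U z) (eval_fps U (lam * z))"
proof -
  define M where "M = max 1 (norm lam)"
  define V where "V = fps_scale lam U"
  have M: "M \<ge> 1" by (simp add: M_def)
  have UM: "coeffs_bounded (s * M) \<epsilon> N U" for N
    using coeffs_bounded_scale[OF U, of 1 M N] M s \<epsilon> by (simp add: fps_scale_1)
  have VM: "coeffs_bounded (s * M) \<epsilon> N V" for N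
    unfolding V_def using U s \<epsilon> by (intro coeffs_bounded_scale) (auto simp: M_def)
  have radius: "fps_conv_radius Q \<ge> ereal (1 / (s * M))"
    if "\<And>N. coeffs_bounded (s * M) \<epsilon> N Q" for Q
    using fps_conv_radius_ge_of_norm_le[OF coeffs_bounded_norm_le[OF that]] s M \<epsilon> by auto
  have zU: "ereal (norm z) < fps_conv_radius U" and zV: "ereal (norm z) < fps_conv_radius V"
    and z2U: "ereal (norm (lam\<^sup>2 * z)) < fps_conv_radius U"
    using radius[OF UM] radius[OF VM] z z2 unfolding M_def[symmetric]
    by (meson ereal_less_eq(3) less_ereal.simps(1) less_le_trans)+
  have b: "(\<lambda>(i, j). norm (b i j)) summable_on {(i, j). i + j \<ge> 2}"
    by (rule power_series2_coeffs_abs_summable[OF g])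
  have G: "(\<lambda>n. fps_nth (fps_subst2 b U V) n * z ^ n) sums g (eval_fps U z) (eval_fps U (lam * z))"
    using UM VM \<epsilon> s M z
    by (intro fps_subst2_sums[OF _ b, where \<sigma> = "s * M" and c = \<epsilon>])
       (auto simp: M_def V_def eval_fps_scale g)
  have "(\<lambda>n. - \<beta> * (fps_nth U n * z ^ n) - \<alpha> * (fps_nth V n * z ^ n)
        + fps_nth (fps_subst2 b U V) n * z ^ n)
      sums (- \<beta> * eval_fps U z - \<alpha> * eval_fps V z + g (eval_fps U z) (eval_fps U (lam * z)))"
    by (intro sums_add sums_diff sums_mult eval_fps_sums zU zV G)
  moreover have "- \<beta> * (fps_nth U n * z ^ n) - \<alpha> * (fps_nth V n * z ^ n)
        + fps_nth (fps_subst2 b U V) n * z ^ n = fps_nth U n * (lam\<^sup>2 * z) ^ n" for n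
  proof -
    have "fps_scale (lam\<^sup>2) U = - fps_const \<beta> * U - fps_const \<alpha> * V + fps_subst2 b U V"
      using formal by (simp add: formal_solution_def Let_def U_def V_def)
    then have "(lam\<^sup>2) ^ n * fps_nth U n
        = - \<beta> * fps_nth U n - \<alpha> * fps_nth V n + fps_nth (fps_subst2 b U V) n"
      by (simp add: fps_eq_iff fps_nth_scale flip: fps_const_neg)
    then have "z ^ n * ((lam\<^sup>2) ^ n * fps_nth U n)
        = z ^ n * (- \<beta> * fps_nth U n - \<alpha> * fps_nth V n + fps_nth (fps_subst2 b U V) n)"
      by simp
    then show ?thesis by (simp add: power_mult_distrib algebra_simps)
  qed
  ultimately have "(\<lambda>n. fps_nth U n * (lam\<^sup>2 * z) ^ n)
      sums (- \<beta> * eval_fps U z - \<alpha> * eval_fps V z + g (eval_fps U z) (eval_fps U (lam * z)))"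
    by simp
  then show ?thesis
    using eval_fps_sums[OF z2U] by (simp add: sums_unique2 V_def eval_fps_scale)
qed

theorem theorem1:
  fixes f g :: "complex \<Rightarrow> complex \<Rightarrow> complex"
    and b :: "nat \<Rightarrow> nat \<Rightarrow> complex"
    and \<alpha> \<beta> lam1 lam2 lam L a\<^sub>1 :: complex
    and a :: "nat \<Rightarrow> complex"
  assumes "entire2 f"
    and "\<And>x y. f x y = - \<beta> * x - \<alpha> * y + g x y"
    and "\<beta> \<noteq> 0"
    and "\<And>x y. ((\<lambda>(i, j). b i j * x ^ i * y ^ j) has_sum g x y) {(i, j). i + j \<ge> 2}"
    and "\<exists>x y. g x y \<noteq> 0"
    and "{z. char_fun \<alpha> \<beta> z = 0} = {lam1, lam2}"
    and "norm lam1 \<le> norm lam2"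
    and "norm lam1 < 1 \<and> lam = lam1 \<or> norm lam2 > 1 \<and> lam = lam2"
    and "\<And>k::nat. k \<ge> 1 \<Longrightarrow> lam1 ^ k \<noteq> lam2 \<and> lam2 ^ k \<noteq> lam1"
    and "exp L = lam"
    and "a\<^sub>1 \<noteq> 0"
    and "a 1 = a\<^sub>1"
    and "formal_solution \<alpha> \<beta> b lam a"
  shows "\<exists>\<eta>>0. \<exists>u.
    (\<forall>t \<in> soln_region L \<eta>.
       (\<lambda>n. a (Suc n) * exp (of_nat (Suc n) * t * L)) sums u t) \<and>
    holomorphic_solution f (soln_region L \<eta>) u"
proof -
  note g = assms(4) and formal = assms(13)
  have lam: "norm lam \<noteq> 1" "lam \<noteq> 0" using assms(8,10) by auto
  have nz: "char_fun \<alpha> \<beta> (lam ^ k) \<noteq> 0" if k: "k \<ge> 2" for k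
  proof
    assume "char_fun \<alpha> \<beta> (lam ^ k) = 0"
    then have "lam ^ k = lam1 \<or> lam ^ k = lam2" using assms(6) by blast
    then have "lam ^ k = lam" using assms(8) assms(9)[of k] k by auto
    then have "lam ^ (k - 1) = 1" using k lam(2) by (cases k) auto
    then have "norm lam ^ (k - 1) = 1" by (metis norm_one norm_power)
    then show False using lam(1) k using power_eq_iff_eq_base[of "k - 1" "norm lam" 1] by simp
  qed
  obtain K where K: "K > 0"
    "\<And>k. k \<ge> 2 \<Longrightarrow> max 1 (norm lam) ^ k \<le> K * norm (char_fun \<alpha> \<beta> (lam ^ k))"
    using norm_char_fun_power_ge[OF assms(3) lam(1) nz] by blast
  have b: "(\<lambda>(i, j). norm (b i j)) summable_on {(i, j). i + j \<ge> 2}"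
    by (rule power_series2_coeffs_abs_summable[OF g])
  define B where "B = (\<Sum>\<^sub>\<infinity>(i, j)\<in>{(i, j). i + j \<ge> 2}. norm (b i j))"
  have B: "(\<Sum>(i, j)\<in>F. norm (b i j)) \<le> B" if "finite F" "F \<subseteq> {(i, j). i + j \<ge> 2}" for F
    unfolding B_def using b that by (intro finite_sum_le_infsum) auto
  have "B \<ge> 0" using B[of "{}"] by simp
  define \<epsilon> where "\<epsilon> = 1 / (8 * (1 + K * B))"
  have KB: "K * B \<ge> 0" using K(1) \<open>B \<ge> 0\<close> by simp
  then have \<epsilon>: "\<epsilon> > 0" "8 * \<epsilon> \<le> 1" "8 * K * B * \<epsilon> \<le> 1"
    by (auto simp: \<epsilon>_def field_simps)
  define s where "s = norm (a 1) / \<epsilon>"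
  have s: "s > 0" "norm (a 1) \<le> \<epsilon> * s" using \<epsilon> assms(11,12) by (auto simp: s_def)
  define U where "U = fps_of_coeffs a"
  have U: "coeffs_bounded s \<epsilon> N U" for N
    unfolding U_def using s by (intro formal_solution_coeffs_bounded[OF formal K B \<epsilon>]) auto
  define \<eta> where "\<eta> = 1 / (s * max 1 (norm lam))"
  define u where "u t = eval_fps U (exp (t * L))" for t
  have "\<eta> \<le> 1 / s" using s by (auto simp: \<eta>_def intro!: divide_left_mono)
  moreover have "ereal (1 / s) \<le> fps_conv_radius U"
    using fps_conv_radius_ge_of_norm_le[OF coeffs_bounded_norm_le[OF U]] s \<epsilon> by simp
  ultimately have radius: "ereal (norm (exp (t * L))) < fps_conv_radius U" if "t \<in> soln_region L \<eta>" for t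
    using that unfolding soln_region_def
    by (smt (verit) ereal_less_eq(3) less_ereal.simps(1) less_le_trans mem_Collect_eq)
  have "(\<lambda>n. a (Suc n) * exp (of_nat (Suc n) * t * L)) sums u t" if "t \<in> soln_region L \<eta>" for t
  proof -
    have "(\<lambda>n. fps_nth U (Suc n) * exp (t * L) ^ Suc n) sums u t"
      using eval_fps_sums[OF radius[OF that]]
      by (subst sums_Suc_iff) (simp add: u_def U_def fps_of_coeffs_def)
    then show ?thesis
      by (simp add: U_def fps_of_coeffs_def mult.assoc del: power_Suc of_nat_Suc flip: exp_of_nat_mult)
  qed
  moreover have "u holomorphic_on soln_region L \<eta>"
    unfolding u_def
    using radius
    by (intro holomorphic_on_compose_gen[unfolded o_def,
          OF _ holomorphic_on_eval_fps[of "eball 0 (fps_conv_radius U)" U]] holomorphic_intros)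
       (auto simp: eball_def)
  moreover have "u (t + 2) = f (u t) (u (t + 1))"
    if "t \<in> soln_region L \<eta>" "t + 2 \<in> soln_region L \<eta>" for t
  proof -
    have shift: "exp ((t + 1) * L) = lam * exp (t * L)" "exp ((t + 2) * L) = lam\<^sup>2 * exp (t * L)"
      using assms(10) by (auto simp: distrib_right exp_add exp_double)
    then show ?thesis
      using formal_solution_functional_equation[OF formal g U[unfolded U_def], of "exp (t * L)"]
        \<epsilon> s that assms(2)
      by (simp add: u_def U_def soln_region_def \<eta>_def del: norm_exp_eq_Re)
  qed
  moreover have "\<eta> > 0" using s by (simp add: \<eta>_def)
  ultimately show ?thesis unfolding holomorphic_solution_def by blast
qed

end
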